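(* Let $G$ be a topological group, let $X$ be an arbitrary binary $G$-space, and let $x,y\in X$ and $g\in G$ be arbitrary. Then $G_{(x,g(x,y))}=gG_{(x,y)}g^{-1}$.
   Context: Let $G$ be a topological group with identity $e$ and $X$ a topological space. A binary action of $G$ on $X$ is a continuous map $\alpha:G\times X^2\to X$, written $g(x,y)=\alpha(g,x,y)$, such that $gh(x,y)=g(x,h(x,y))$ and $e(x,y)=y$ for all $g,h\in G$ and $x,y\in X$ (here $gh(x,y)$ means $(gh)(x,y)$). A space $X$ with a fixed binary action of $G$ is called a binary $G$-space. For points $x,y$ of a binary $G$-space, the stationary subgroup of the pair $(x,y)$ is $G_{(x,y)}=\{g\in G : g(x,y)=y\}$. *)

theory Defs
  imports "HOL-Algebra.Coset" "HOL-Analysis.Product_Topology"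
begin

text \<open>No separation axiom is imposed on the topology of the group.\<close>

locale topological_group = group G for G (structure) +
  fixes T :: "'a topology"
  assumes topspace_eq_carrier: "topspace T = carrier G"
    and continuous_mult: "continuous_map (prod_topology T T) T (\<lambda>(g, h). g \<otimes> h)"
    and continuous_inv: "continuous_map T T (\<lambda>g. inv g)"

text \<open>
  The value \<open>\<alpha> g x y\<close> is written \<open>g(x, y)\<close> in informal notation.  Closure of \<open>topspace X\<close> under the
  action is part of \<open>continuous_map\<close>; values of \<open>\<alpha>\<close> outside the carriers are irrelevant.
\<close>

locale binary_G_space = topological_group G T for G (structure) and T +
  fixes X :: "'b topology" and \<alpha> :: "'a \<Rightarrow> 'b \<Rightarrow> 'b \<Rightarrow> 'b"
  assumes continuous_action:
      "continuous_map (prod_topology T (prod_topology X X)) X (\<lambda>(g, x, y). \<alpha> g x y)"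
    and action_mult:
      "\<lbrakk>g \<in> carrier G; h \<in> carrier G; x \<in> topspace X; y \<in> topspace X\<rbrakk>
        \<Longrightarrow> \<alpha> (g \<otimes> h) x y = \<alpha> g x (\<alpha> h x y)"
    and action_one: "\<lbrakk>x \<in> topspace X; y \<in> topspace X\<rbrakk> \<Longrightarrow> \<alpha> \<one> x y = y"

definition stationary_subgroup ::
  "('a, 'm) monoid_scheme \<Rightarrow> ('a \<Rightarrow> 'b \<Rightarrow> 'b \<Rightarrow> 'b) \<Rightarrow> 'b \<Rightarrow> 'b \<Rightarrow> 'a set"
  where "stationary_subgroup G \<alpha> x y = {g \<in> carrier G. \<alpha> g x y = y}"

end

theory Submission
  imports Defs
begin

text \<open>
  For a fixed first coordinate \<open>x\<close>, the assignment \<open>y \<mapsto> g(x, y)\<close> is an ordinary action of the group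
  on the space, because the first coordinate is never moved.  The proposition is then the usual
  conjugation rule for stabilizers of points in one orbit: \<open>k\<close> fixes \<open>g(x, y)\<close> exactly when
  \<open>g\<inverse>kg\<close> fixes \<open>y\<close>, and conjugation by \<open>g\<close> turns this into a description of the stabilizer.
\<close>

text \<open>
  Reduces the identity of sets to a condition on single group elements: conjugation by \<open>g\<close> is a
  bijection of the group with inverse \<open>k \<mapsto> g\<inverse>kg\<close>, so a conjugate set is a preimage.
\<close>

lemma (in group) conjugate_set_iff:
  assumes "g \<in> carrier G" "H \<subseteq> carrier G"
  shows "k \<in> (g <# H) #> inv g \<longleftrightarrow> k \<in> carrier G \<and> inv g \<otimes> k \<otimes> g \<in> H"
proof
  assume "k \<in> (g <# H) #> inv g"
  then obtain h where h: "h \<in> H" "k = g \<otimes> h \<otimes> inv g"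
    by (auto simp: l_coset_def r_coset_def)
  then have "inv g \<otimes> k \<otimes> g = h"
    using assms by (simp add: m_assoc inv_solve_left' subset_iff)
  with h assms show "k \<in> carrier G \<and> inv g \<otimes> k \<otimes> g \<in> H"
    by auto
next
  assume k: "k \<in> carrier G \<and> inv g \<otimes> k \<otimes> g \<in> H"
  have "g \<otimes> (inv g \<otimes> k) = k"
    using k assms by (simp flip: m_assoc)
  then have "k = g \<otimes> (inv g \<otimes> k \<otimes> g) \<otimes> inv g"
    using k assms by (simp add: m_assoc)
  with k show "k \<in> (g <# H) #> inv g"
    unfolding l_coset_def r_coset_def by blast
qed

context binary_G_space
begin

lemma action_closed:
  assumes "g \<in> carrier G" "x \<in> topspace X" "y \<in> topspace X"
  shows "\<alpha> g x y \<in> topspace X"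
  using continuous_map_image_subset_topspace[OF continuous_action] assms
  by (auto simp: topspace_eq_carrier image_subset_iff)

lemma action_inv_cancel:
  assumes "g \<in> carrier G" "x \<in> topspace X" "y \<in> topspace X"
  shows "\<alpha> (inv g) x (\<alpha> g x y) = y"
  using assms by (simp add: action_one flip: action_mult)

lemma action_inv_eq_iff:
  assumes "g \<in> carrier G" "x \<in> topspace X" "y \<in> topspace X" "z \<in> topspace X"
  shows "\<alpha> (inv g) x z = y \<longleftrightarrow> z = \<alpha> g x y"
  using assms action_inv_cancel[of g x y] action_inv_cancel[of "inv g" x z] by auto

end

theorem proposition4p2:
  fixes G :: "('a, 'm) monoid_scheme" (structure)
    and T :: "'a topology"
    and X :: "'b topology"
    and \<alpha> :: "'a \<Rightarrow> 'b \<Rightarrow> 'b \<Rightarrow> 'b"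
  assumes "binary_G_space G T X \<alpha>"
    and "x \<in> topspace X" and "y \<in> topspace X" and "g \<in> carrier G"
  shows "stationary_subgroup G \<alpha> x (\<alpha> g x y) =
    (g <# stationary_subgroup G \<alpha> x y) #> inv g"
proof -
  interpret binary_G_space G T X \<alpha> by fact
  have sub: "stationary_subgroup G \<alpha> x y \<subseteq> carrier G"
    by (auto simp: stationary_subgroup_def)
  have "\<alpha> (inv g \<otimes> k \<otimes> g) x y = y \<longleftrightarrow> \<alpha> k x (\<alpha> g x y) = \<alpha> g x y"
    if "k \<in> carrier G" for k
  proof -
    have "\<alpha> (inv g \<otimes> k \<otimes> g) x y = \<alpha> (inv g) x (\<alpha> k x (\<alpha> g x y))"
      using that assms by (simp add: action_mult action_closed)
    then show ?thesis
      using that assms by (simp add: action_inv_eq_iff action_closed)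
  qed
  then have "k \<in> stationary_subgroup G \<alpha> x (\<alpha> g x y) \<longleftrightarrow>
      k \<in> carrier G \<and> inv g \<otimes> k \<otimes> g \<in> stationary_subgroup G \<alpha> x y" for k
    using \<open>g \<in> carrier G\<close> by (auto simp: stationary_subgroup_def)
  then show ?thesis
    using conjugate_set_iff[OF \<open>g \<in> carrier G\<close> sub] by blast
qed

end
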